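(* Let $u : A \to B$, $v : A \to C$ and $w : B \to C$ be $\omega$-functors between $\omega$-categories such that $w\circ u=v$. If for every object ($0$-cell) $c_0$ of $C$ the induced $\omega$-functor $u/c_0 : A/c_0 \to B/c_0$ is an equivalence of $\omega$-categories, then $u$ is an equivalence of $\omega$-categories.
   Context: $\omega$-categories. An $\omega$-category means a small strict globular $\omega$-category $C$: sets $C_n$ of $n$-cells ($n\ge 0$), source and target maps $s,t : C_{n+1}\to C_n$ with $ss=st$, $tt=ts$ (iterated to $s_k,t_k : C_n\to C_k$), units $x\mapsto 1_x$ (iterated units are used implicitly to compose cells of different dimensions), and compositions $x *_k y$ of $n$-cells with $s_k(x)=t_k(y)$, $0\le k<n$, satisfying the usual source/target, unit, functoriality of units, associativity and exchange axioms. $\omega$-functors preserve all this structure. Convention: for $k<l$, $*_k$ has priority over $*_l$. Write $\alpha : x\to y$ if $s(\alpha)=x$, $t(\alpha)=y$. Two $n$-cells are parallel if $n=0$ or they have the same source and target. Equivalences of $\omega$-categories. The relation $\sim_\omega$ on cells of $C$ is defined coinductively (it is the largest relation with the following property): for $x,y\in C_n$, $x\sim_\omega y$ iff $x,y$ are parallel and there are $(n+1)$-cells $r:x\to y$, $q:y\to x$ with $r*_n q\sim_\omega 1_y$ and $q*_n r\sim_\omega 1_x$. An $\omega$-functor $F:C\to D$ is an equivalence of $\omega$-categories if (a) for every $y\in D_0$ there is $x\in C_0$ with $F(x)\sim_\omega y$; (b) for every $n\ge0$, all parallel $x,y\in C_n$ and every $(n+1)$-cell $\beta:F(x)\to F(y)$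 there is an $(n+1)$-cell $\alpha:x\to y$ of $C$ with $F(\alpha)\sim_\omega\beta$. Oplax transformations. For $\omega$-functors $f,g:X\to Y$, an oplax transformation $\alpha:f\Rightarrow g$ consists of a $1$-cell $\alpha_x:f(x)\to g(x)$ for each $0$-cell $x$ of $X$ and, for each $n$-cell $x$ of $X$, $n>0$, an $(n+1)$-cell $$\alpha_x:\alpha_{t_{n-1}(x)}*_{n-1}\cdots*_1\alpha_{t_0(x)}*_0 f(x)\to g(x)*_0\alpha_{s_0(x)}*_1\cdots*_{n-1}\alpha_{s_{n-1}(x)},$$ such that $\alpha_{1_x}=1_{\alpha_x}$ and, for $k$-composable $n$-cells $x,y$, $$\alpha_{x*_k y}=\bigl(g(t_{k+1}(x))*_0\alpha_{s_0(y)}*_1\cdots*_{k-1}\alpha_{s_{k-1}(y)}*_k\alpha_y\bigr)*_{k+1}\bigl(\alpha_x*_k\alpha_{t_{k-1}(x)}*_{k-1}\cdots*_1\alpha_{t_0(x)}*_0 f(s_{k+1}(y))\bigr).$$ (Equivalently, it is an $\omega$-functor $\mathbb{D}_1\otimes X\to Y$ for the Gray tensor product restricting to $f$ and $g$ at the two ends, or an $\omega$-functor $X\to\underline{\hom}_{\mathrm{lax}}(\mathbb{D}_1,Y)$, where $\mathbb{D}_1$ is the category $\bullet\to\bullet$.) Slices. For an $\omega$-functor $v:A\to C$ and an object $c_0$ of $C$, $A/c_0$ is the $\omega$-category such that $\omega$-functors $X\to A/c_0$ correspond, naturally in $X$, to pairs $(f,\alpha)$ with $f:X\to A$ an $\omega$-functor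 and $\alpha: v\circ f\Rightarrow \underline{c_0}$ an oplax transformation to the constant $\omega$-functor with value $c_0$. (Explicitly, $C/c_0$ is the fibre over $c_0$ of the target projection $\underline{\hom}_{\mathrm{lax}}(\mathbb{D}_1,C)\to C$, with projection $C/c_0\to C$ given by the source projection, and $A/c_0=A\times_C C/c_0$. For instance a $0$-cell is a pair $(x_0, c_1:v(x_0)\to c_0)$, and a $1$-cell from $(x_0,c_1)$ to $(x_0',c_1')$ is a pair $(x_1:x_0\to x_0',\ c_2:c_1'*_0v(x_1)\to c_1)$.) $B/c_0$ is defined in the same way from $w:B\to C$. Given $w\circ u=v$, the $\omega$-functor $u/c_0:A/c_0\to B/c_0$ is the one induced by $(f,\alpha)\mapsto(u\circ f,\alpha)$. *)

theory Defs
  imports Main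
begin

section \<open>Strict omega-categories and omega-functors\<close>

text \<open>
  The sets of cells of different dimensions need not be disjoint, so every operation carries the
  dimension of its arguments: \<open>Src C n\<close> and \<open>Tgt C n\<close> go from \<open>(n+1)\<close>-cells to \<open>n\<close>-cells,
  \<open>Unit C n\<close> goes from \<open>n\<close>-cells to \<open>(n+1)\<close>-cells, and \<open>Comp C n k x y\<close> is the composite
  \<open>x *\<^sub>k y\<close> of two \<open>n\<close>-cells, meaningful only if \<open>k < n\<close> and \<open>s\<^sub>k x = t\<^sub>k y\<close>.
\<close>

record 'a omega_cat =
  Cell :: "nat \<Rightarrow> 'a set"
  Src :: "nat \<Rightarrow> 'a \<Rightarrow> 'a"
  Tgt :: "nat \<Rightarrow> 'a \<Rightarrow> 'a"
  Unit :: "nat \<Rightarrow> 'a \<Rightarrow> 'a"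
  Comp :: "nat \<Rightarrow> nat \<Rightarrow> 'a \<Rightarrow> 'a \<Rightarrow> 'a"

text \<open>
  Iterated sources and targets of an \<open>n\<close>-cell in dimension \<open>k \<le> n\<close>, and iterated units of an
  \<open>m\<close>-cell in dimension \<open>n \<ge> m\<close>.
\<close>

primrec isrc :: "'a omega_cat \<Rightarrow> nat \<Rightarrow> nat \<Rightarrow> 'a \<Rightarrow> 'a" where
  "isrc C k 0 x = x"
| "isrc C k (Suc n) x = (if k \<le> n then isrc C k n (Src C n x) else x)"

primrec itgt :: "'a omega_cat \<Rightarrow> nat \<Rightarrow> nat \<Rightarrow> 'a \<Rightarrow> 'a" where
  "itgt C k 0 x = x"
| "itgt C k (Suc n) x = (if k \<le> n then itgt C k n (Tgt C n x) else x)"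

primrec iunit :: "'a omega_cat \<Rightarrow> nat \<Rightarrow> nat \<Rightarrow> 'a \<Rightarrow> 'a" where
  "iunit C m 0 x = x"
| "iunit C m (Suc n) x = (if m \<le> n then Unit C n (iunit C m n x) else x)"

definition composable :: "'a omega_cat \<Rightarrow> nat \<Rightarrow> nat \<Rightarrow> 'a \<Rightarrow> 'a \<Rightarrow> bool" where
  "composable C n k x y \<longleftrightarrow>
     k < n \<and> x \<in> Cell C n \<and> y \<in> Cell C n \<and> isrc C k n x = itgt C k n y"

definition omega_category :: "'a omega_cat \<Rightarrow> bool" where
  "omega_category C \<longleftrightarrow>
     (\<forall>n. \<forall>x\<in>Cell C (Suc n). Src C n x \<in> Cell C n \<and> Tgt C n x \<in> Cell C n) \<and>
     (\<forall>n. \<forall>x\<in>Cell C (Suc (Suc n)).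
        Src C n (Src C (Suc n) x) = Src C n (Tgt C (Suc n) x) \<and>
        Tgt C n (Tgt C (Suc n) x) = Tgt C n (Src C (Suc n) x)) \<and>
     (\<forall>n. \<forall>x\<in>Cell C n. Unit C n x \<in> Cell C (Suc n) \<and>
        Src C n (Unit C n x) = x \<and> Tgt C n (Unit C n x) = x) \<and>
     (\<forall>n k x y. composable C n k x y \<longrightarrow> Comp C n k x y \<in> Cell C n) \<and>
     (\<forall>n x y. composable C (Suc n) n x y \<longrightarrow>
        Src C n (Comp C (Suc n) n x y) = Src C n y \<and>
        Tgt C n (Comp C (Suc n) n x y) = Tgt C n x) \<and>
     (\<forall>n k x y. k < n \<and> composable C (Suc n) k x y \<longrightarrow>
        Src C n (Comp C (Suc n) k x y) = Comp C n k (Src C n x) (Src C n y) \<and>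
        Tgt C n (Comp C (Suc n) k x y) = Comp C n k (Tgt C n x) (Tgt C n y)) \<and>
     (\<forall>n k. \<forall>x\<in>Cell C n. k < n \<longrightarrow>
        Comp C n k (iunit C k n (itgt C k n x)) x = x \<and>
        Comp C n k x (iunit C k n (isrc C k n x)) = x) \<and>
     (\<forall>n k x y. composable C n k x y \<longrightarrow>
        Unit C n (Comp C n k x y) = Comp C (Suc n) k (Unit C n x) (Unit C n y)) \<and>
     (\<forall>n k x y z. composable C n k x y \<and> composable C n k y z \<longrightarrow>
        Comp C n k (Comp C n k x y) z = Comp C n k x (Comp C n k y z)) \<and>
     (\<forall>n j k x y z w. j < k \<and>
        composable C n k x y \<and> composable C n k z w \<and>
        composable C n j x z \<and> composable C n j y w \<longrightarrow>
        Comp C n j (Comp C n k x y) (Comp C n k z w) =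
        Comp C n k (Comp C n j x z) (Comp C n j y w))"

definition omega_functor ::
    "'a omega_cat \<Rightarrow> 'b omega_cat \<Rightarrow> (nat \<Rightarrow> 'a \<Rightarrow> 'b) \<Rightarrow> bool" where
  "omega_functor C D F \<longleftrightarrow>
     (\<forall>n. \<forall>x\<in>Cell C n. F n x \<in> Cell D n) \<and>
     (\<forall>n. \<forall>x\<in>Cell C (Suc n).
        F n (Src C n x) = Src D n (F (Suc n) x) \<and>
        F n (Tgt C n x) = Tgt D n (F (Suc n) x)) \<and>
     (\<forall>n. \<forall>x\<in>Cell C n. F (Suc n) (Unit C n x) = Unit D n (F n x)) \<and>
     (\<forall>n k x y. composable C n k x y \<longrightarrow>
        F n (Comp C n k x y) = Comp D n k (F n x) (F n y))"

section \<open>Equivalences of omega-categories\<close>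

definition parallel :: "'a omega_cat \<Rightarrow> nat \<Rightarrow> 'a \<Rightarrow> 'a \<Rightarrow> bool" where
  "parallel C n x y \<longleftrightarrow> x \<in> Cell C n \<and> y \<in> Cell C n \<and>
     (\<forall>m. n = Suc m \<longrightarrow> Src C m x = Src C m y \<and> Tgt C m x = Tgt C m y)"

definition arrow :: "'a omega_cat \<Rightarrow> nat \<Rightarrow> 'a \<Rightarrow> 'a \<Rightarrow> 'a \<Rightarrow> bool" where
  "arrow C n r x y \<longleftrightarrow> r \<in> Cell C (Suc n) \<and> Src C n r = x \<and> Tgt C n r = y"

coinductive omega_equiv :: "'a omega_cat \<Rightarrow> nat \<Rightarrow> 'a \<Rightarrow> 'a \<Rightarrow> bool" for C where
  "\<lbrakk> parallel C n x y; arrow C n r x y; arrow C n q y x;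
     omega_equiv C (Suc n) (Comp C (Suc n) n r q) (Unit C n y);
     omega_equiv C (Suc n) (Comp C (Suc n) n q r) (Unit C n x) \<rbrakk>
   \<Longrightarrow> omega_equiv C n x y"

definition omega_equivalence ::
    "'a omega_cat \<Rightarrow> 'b omega_cat \<Rightarrow> (nat \<Rightarrow> 'a \<Rightarrow> 'b) \<Rightarrow> bool" where
  "omega_equivalence C D F \<longleftrightarrow>
     omega_functor C D F \<and>
     (\<forall>y\<in>Cell D 0. \<exists>x\<in>Cell C 0. omega_equiv D 0 (F 0 x) y) \<and>
     (\<forall>n x y \<beta>. parallel C n x y \<and> arrow D n \<beta> (F n x) (F n y) \<longrightarrow>
        (\<exists>\<alpha>. arrow C n \<alpha> x y \<and> omega_equiv D (Suc n) (F (Suc n) \<alpha>) \<beta>))"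

section \<open>Oplax transformations\<close>

text \<open>
  For an \<open>n\<close>-cell \<open>z\<close> and \<open>(j+1)\<close>-cells \<open>a j\<close>, \<open>oplax_left C n a k z\<close> is the \<open>n\<close>-cell
  \<open>a (k-1) *\<^bsub>k-1\<^esub> \<dots> *\<^sub>1 a 0 *\<^sub>0 z\<close> and \<open>oplax_right C n z a k\<close> is the \<open>n\<close>-cell
  \<open>z *\<^sub>0 a 0 *\<^sub>1 \<dots> *\<^bsub>k-1\<^esub> a (k-1)\<close>, where lower compositions are performed first.
\<close>

primrec oplax_left ::
    "'a omega_cat \<Rightarrow> nat \<Rightarrow> (nat \<Rightarrow> 'a) \<Rightarrow> nat \<Rightarrow> 'a \<Rightarrow> 'a" where
  "oplax_left C n a 0 z = z"
| "oplax_left C n a (Suc k) z = Comp C n k (iunit C (Suc k) n (a k)) (oplax_left C n a k z)"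

primrec oplax_right ::
    "'a omega_cat \<Rightarrow> nat \<Rightarrow> 'a \<Rightarrow> (nat \<Rightarrow> 'a) \<Rightarrow> nat \<Rightarrow> 'a" where
  "oplax_right C n z a 0 = z"
| "oplax_right C n z a (Suc k) = Comp C n k (oplax_right C n z a k) (iunit C (Suc k) n (a k))"

text \<open>
  The value of an oplax transformation \<open>f \<Rightarrow> g\<close> on a composite \<open>x *\<^sub>k y\<close> of \<open>n\<close>-cells.  The
  arguments stand for \<open>g (t\<^bsub>k+1\<^esub> x)\<close>, the values on the \<open>s\<^sub>j y\<close>, the value on \<open>y\<close>, the value on \<open>x\<close>,
  the values on the \<open>t\<^sub>j x\<close>, and \<open>f (s\<^bsub>k+1\<^esub> y)\<close>.
\<close>

definition oplax_comp ::
    "'a omega_cat \<Rightarrow> nat \<Rightarrow> nat \<Rightarrow> 'a \<Rightarrow> (nat \<Rightarrow> 'a) \<Rightarrow> 'a \<Rightarrow> 'a \<Rightarrow> (nat \<Rightarrow> 'a) \<Rightarrow> 'a \<Rightarrow> 'a" where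
  "oplax_comp C n k gx sy \<alpha>y \<alpha>x tx fy =
     Comp C (Suc n) (Suc k)
       (Comp C (Suc n) k (iunit C (Suc k) (Suc n) (oplax_right C (Suc k) gx sy k)) \<alpha>y)
       (Comp C (Suc n) k \<alpha>x (iunit C (Suc k) (Suc n) (oplax_left C (Suc k) tx k fy)))"

definition oplax_transformation ::
    "'a omega_cat \<Rightarrow> 'b omega_cat \<Rightarrow> (nat \<Rightarrow> 'a \<Rightarrow> 'b) \<Rightarrow> (nat \<Rightarrow> 'a \<Rightarrow> 'b) \<Rightarrow>
     (nat \<Rightarrow> 'a \<Rightarrow> 'b) \<Rightarrow> bool" where
  "oplax_transformation X Y f g \<alpha> \<longleftrightarrow>
     (\<forall>n. \<forall>x\<in>Cell X n. arrow Y n (\<alpha> n x)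
        (oplax_left Y n (\<lambda>j. \<alpha> j (itgt X j n x)) n (f n x))
        (oplax_right Y n (g n x) (\<lambda>j. \<alpha> j (isrc X j n x)) n)) \<and>
     (\<forall>n. \<forall>x\<in>Cell X n. \<alpha> (Suc n) (Unit X n x) = Unit Y (Suc n) (\<alpha> n x)) \<and>
     (\<forall>n k x y. composable X n k x y \<longrightarrow>
        \<alpha> n (Comp X n k x y) =
          oplax_comp Y n k
            (g (Suc k) (itgt X (Suc k) n x)) (\<lambda>j. \<alpha> j (isrc X j n y)) (\<alpha> n y)
            (\<alpha> n x) (\<lambda>j. \<alpha> j (itgt X j n x)) (f (Suc k) (isrc X (Suc k) n y)))"

definition const_functor :: "'b omega_cat \<Rightarrow> 'b \<Rightarrow> nat \<Rightarrow> 'a \<Rightarrow> 'b" where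
  "const_functor C c n x = iunit C 0 n c"

section \<open>Slices\<close>

text \<open>
  An \<open>n\<close>-cell of \<open>A/c\<close> is an \<open>n\<close>-cell \<open>x\<close> of \<open>A\<close> (the \<open>base\<close>) with the values of an oplax
  transformation to the constant functor on all its iterated faces: on \<open>s\<^sub>j x\<close> for \<open>j < n\<close>
  (the list \<open>srcs\<close>), on \<open>t\<^sub>j x\<close> for \<open>j < n\<close> (the list \<open>tgts\<close>), and on \<open>x\<close> itself (\<open>top\<close>).
\<close>

datatype ('a, 'c) slice_cell =
  SliceCell (base: 'a) (srcs: "'c list") (tgts: "'c list") (top: 'c)

definition slice_src ::
    "'a omega_cat \<Rightarrow> nat \<Rightarrow> ('a, 'c) slice_cell \<Rightarrow> ('a, 'c) slice_cell" where
  "slice_src A n Z =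
     SliceCell (Src A n (base Z)) (butlast (srcs Z)) (butlast (tgts Z)) (last (srcs Z))"

definition slice_tgt ::
    "'a omega_cat \<Rightarrow> nat \<Rightarrow> ('a, 'c) slice_cell \<Rightarrow> ('a, 'c) slice_cell" where
  "slice_tgt A n Z =
     SliceCell (Tgt A n (base Z)) (butlast (srcs Z)) (butlast (tgts Z)) (last (tgts Z))"

definition slice_unit ::
    "'a omega_cat \<Rightarrow> 'c omega_cat \<Rightarrow> nat \<Rightarrow> ('a, 'c) slice_cell \<Rightarrow> ('a, 'c) slice_cell" where
  "slice_unit A C n Z =
     SliceCell (Unit A n (base Z)) (srcs Z @ [top Z]) (tgts Z @ [top Z]) (Unit C (Suc n) (top Z))"

definition slice_top ::
    "'a omega_cat \<Rightarrow> (nat \<Rightarrow> 'a \<Rightarrow> 'c) \<Rightarrow> 'c omega_cat \<Rightarrow> 'c \<Rightarrow> nat \<Rightarrow>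
     ('a, 'c) slice_cell \<Rightarrow> bool" where
  "slice_top A v C c n Z \<longleftrightarrow>
     base Z \<in> Cell A n \<and> length (srcs Z) = n \<and> length (tgts Z) = n \<and>
     arrow C n (top Z)
       (oplax_left C n (\<lambda>j. tgts Z ! j) n (v n (base Z)))
       (oplax_right C n (const_functor C c n (base Z)) (\<lambda>j. srcs Z ! j) n)"

primrec slice_cells ::
    "'a omega_cat \<Rightarrow> (nat \<Rightarrow> 'a \<Rightarrow> 'c) \<Rightarrow> 'c omega_cat \<Rightarrow> 'c \<Rightarrow> nat \<Rightarrow>
     ('a, 'c) slice_cell set" where
  "slice_cells A v C c 0 = {Z. slice_top A v C c 0 Z}"
| "slice_cells A v C c (Suc n) =
     {Z. slice_top A v C c (Suc n) Z \<and>
         slice_src A n Z \<in> slice_cells A v C c n \<and>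
         slice_tgt A n Z \<in> slice_cells A v C c n}"

text \<open>
  The entries of a composite \<open>X *\<^sub>k Y\<close> are forced by the values of its source and target:
  these are the source of \<open>Y\<close> and the target of \<open>X\<close> if \<open>k\<close> is the codimension-one index, and
  composites of sources and of targets otherwise.  There is no composition of \<open>0\<close>-cells, so
  the first equation is a dummy.
\<close>

primrec slice_comp ::
    "'a omega_cat \<Rightarrow> (nat \<Rightarrow> 'a \<Rightarrow> 'c) \<Rightarrow> 'c omega_cat \<Rightarrow> 'c \<Rightarrow> nat \<Rightarrow> nat \<Rightarrow>
     ('a, 'c) slice_cell \<Rightarrow> ('a, 'c) slice_cell \<Rightarrow> ('a, 'c) slice_cell" where
  "slice_comp A v C c 0 k X Y = X"
| "slice_comp A v C c (Suc n) k X Y =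
     (let S = slice_comp A v C c n k (slice_src A n X) (slice_src A n Y);
          T = slice_comp A v C c n k (slice_tgt A n X) (slice_tgt A n Y)
      in SliceCell
           (Comp A (Suc n) k (base X) (base Y))
           (if k = n then srcs Y else srcs S @ [top S])
           (if k = n then tgts X else tgts T @ [top T])
           (oplax_comp C (Suc n) k
              (const_functor C c (Suc k) (itgt A (Suc k) (Suc n) (base X)))
              (\<lambda>j. srcs Y ! j) (top Y)
              (top X) (\<lambda>j. tgts X ! j)
              (v (Suc k) (isrc A (Suc k) (Suc n) (base Y)))))"

definition slice ::
    "'a omega_cat \<Rightarrow> (nat \<Rightarrow> 'a \<Rightarrow> 'c) \<Rightarrow> 'c omega_cat \<Rightarrow> 'c \<Rightarrow> ('a, 'c) slice_cell omega_cat" where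
  "slice A v C c =
     \<lparr> Cell = slice_cells A v C c, Src = slice_src A, Tgt = slice_tgt A,
       Unit = slice_unit A C, Comp = slice_comp A v C c \<rparr>"

definition slice_map ::
    "(nat \<Rightarrow> 'a \<Rightarrow> 'b) \<Rightarrow> nat \<Rightarrow> ('a, 'c) slice_cell \<Rightarrow> ('b, 'c) slice_cell" where
  "slice_map u n Z = SliceCell (u n (base Z)) (srcs Z) (tgts Z) (top Z)"

section \<open>The universal property of slices\<close>

text \<open>
  Functors \<open>X \<rightarrow> A/c\<close> are the same as pairs \<open>(f, \<alpha>)\<close> of a functor \<open>f: X \<rightarrow> A\<close> and an oplax
  transformation \<open>\<alpha>\<close> from \<open>v \<circ> f\<close> to the constant functor, via \<open>slice_pairing\<close> in one direction
  and \<open>base\<close>, \<open>top\<close> in the other.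
\<close>

definition slice_pairing ::
    "'x omega_cat \<Rightarrow> (nat \<Rightarrow> 'x \<Rightarrow> 'a) \<Rightarrow> (nat \<Rightarrow> 'x \<Rightarrow> 'c) \<Rightarrow> nat \<Rightarrow> 'x \<Rightarrow> ('a, 'c) slice_cell" where
  "slice_pairing X f \<alpha> n x =
     SliceCell (f n x)
       (map (\<lambda>j. \<alpha> j (isrc X j n x)) [0..<n]) (map (\<lambda>j. \<alpha> j (itgt X j n x)) [0..<n]) (\<alpha> n x)"

lemma slice_simps [simp]:
  "Cell (slice A v C c) = slice_cells A v C c"
  "Src (slice A v C c) = slice_src A"
  "Tgt (slice A v C c) = slice_tgt A"
  "Unit (slice A v C c) = slice_unit A C"
  "Comp (slice A v C c) = slice_comp A v C c"
  by (simp_all add: slice_def)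

lemma isrc_self [simp]: "isrc C n n x = x"
  by (cases n) auto

lemma itgt_self [simp]: "itgt C n n x = x"
  by (cases n) auto

lemma oplax_left_cong:
  "(\<And>j. j < k \<Longrightarrow> a j = b j) \<Longrightarrow> oplax_left C n a k z = oplax_left C n b k z"
  by (induction k) auto

lemma oplax_right_cong:
  "(\<And>j. j < k \<Longrightarrow> a j = b j) \<Longrightarrow> oplax_right C n z a k = oplax_right C n z b k"
  by (induction k) auto

lemma oplax_comp_cong:
  assumes "\<And>j. j < k \<Longrightarrow> a j = a' j" "\<And>j. j < k \<Longrightarrow> b j = b' j"
  shows "oplax_comp C n k g a p q b f = oplax_comp C n k g a' p q b' f"
  unfolding oplax_comp_def
  using oplax_left_cong[of k b b'] oplax_right_cong[of k a a'] assms by simp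

context
  fixes C :: "'a omega_cat"
  assumes C: "omega_category C"
begin

lemma Src_Cell: "x \<in> Cell C (Suc n) \<Longrightarrow> Src C n x \<in> Cell C n"
  and Tgt_Cell: "x \<in> Cell C (Suc n) \<Longrightarrow> Tgt C n x \<in> Cell C n"
  and Src_Tgt: "x \<in> Cell C (Suc (Suc n)) \<Longrightarrow> Src C n (Tgt C (Suc n) x) = Src C n (Src C (Suc n) x)"
  and Tgt_Src: "x \<in> Cell C (Suc (Suc n)) \<Longrightarrow> Tgt C n (Src C (Suc n) x) = Tgt C n (Tgt C (Suc n) x)"
  and Unit_Cell: "x \<in> Cell C n \<Longrightarrow> Unit C n x \<in> Cell C (Suc n)"
  and Src_Unit: "x \<in> Cell C n \<Longrightarrow> Src C n (Unit C n x) = x"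
  and Tgt_Unit: "x \<in> Cell C n \<Longrightarrow> Tgt C n (Unit C n x) = x"
  and Comp_Cell: "composable C n k x y \<Longrightarrow> Comp C n k x y \<in> Cell C n"
  and Src_Comp0: "composable C (Suc n) n x y \<Longrightarrow> Src C n (Comp C (Suc n) n x y) = Src C n y"
  and Tgt_Comp0: "composable C (Suc n) n x y \<Longrightarrow> Tgt C n (Comp C (Suc n) n x y) = Tgt C n x"
  and Src_Comp: "composable C (Suc n) k x y \<Longrightarrow> k < n \<Longrightarrow>
        Src C n (Comp C (Suc n) k x y) = Comp C n k (Src C n x) (Src C n y)"
  and Tgt_Comp: "composable C (Suc n) k x y \<Longrightarrow> k < n \<Longrightarrow>
        Tgt C n (Comp C (Suc n) k x y) = Comp C n k (Tgt C n x) (Tgt C n y)"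
  using C unfolding omega_category_def by simp_all

lemma isrc_Tgt: "x \<in> Cell C (Suc n) \<Longrightarrow> j < n \<Longrightarrow> isrc C j n (Tgt C n x) = isrc C j n (Src C n x)"
  by (cases n) (auto simp: Src_Tgt)

lemma itgt_Src: "x \<in> Cell C (Suc n) \<Longrightarrow> j < n \<Longrightarrow> itgt C j n (Src C n x) = itgt C j n (Tgt C n x)"
  by (cases n) (auto simp: Tgt_Src)

lemma composable_Src: "composable C (Suc n) k x y \<Longrightarrow> k < n \<Longrightarrow> composable C n k (Src C n x) (Src C n y)"
  unfolding composable_def by (auto simp: Src_Cell itgt_Src)

lemma composable_Tgt: "composable C (Suc n) k x y \<Longrightarrow> k < n \<Longrightarrow> composable C n k (Tgt C n x) (Tgt C n y)"
  unfolding composable_def by (auto simp: Tgt_Cell isrc_Tgt)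

end

lemma functor_Cell: "omega_functor C D F \<Longrightarrow> x \<in> Cell C n \<Longrightarrow> F n x \<in> Cell D n"
  and functor_Src: "omega_functor C D F \<Longrightarrow> x \<in> Cell C (Suc n) \<Longrightarrow> F n (Src C n x) = Src D n (F (Suc n) x)"
  and functor_Tgt: "omega_functor C D F \<Longrightarrow> x \<in> Cell C (Suc n) \<Longrightarrow> F n (Tgt C n x) = Tgt D n (F (Suc n) x)"
  and functor_Unit: "omega_functor C D F \<Longrightarrow> x \<in> Cell C n \<Longrightarrow> F (Suc n) (Unit C n x) = Unit D n (F n x)"
  and functor_Comp: "omega_functor C D F \<Longrightarrow> composable C n k x y \<Longrightarrow>
        F n (Comp C n k x y) = Comp D n k (F n x) (F n y)"
  unfolding omega_functor_def by blast+

lemma functor_isrc: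
  assumes "omega_category C" "omega_functor C D F" "x \<in> Cell C n" "k \<le> n"
  shows "F k (isrc C k n x) = isrc D k n (F n x)"
  using assms(3,4)
  by (induction n arbitrary: x)
     (auto simp: functor_Src[OF assms(2)] Src_Cell[OF assms(1)] not_le le_Suc_eq)

lemma functor_itgt:
  assumes "omega_category C" "omega_functor C D F" "x \<in> Cell C n" "k \<le> n"
  shows "F k (itgt C k n x) = itgt D k n (F n x)"
  using assms(3,4)
  by (induction n arbitrary: x)
     (auto simp: functor_Tgt[OF assms(2)] Tgt_Cell[OF assms(1)] not_le le_Suc_eq)

lemma slice_pairing_Src:
  assumes "omega_category X" "omega_functor X A f" "x \<in> Cell X (Suc n)"
  shows "slice_src A n (slice_pairing X f \<alpha> (Suc n) x) = slice_pairing X f \<alpha> n (Src X n x)"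
  using assms
  by (auto simp: slice_src_def slice_pairing_def functor_Src itgt_Src)

lemma slice_pairing_Tgt:
  assumes "omega_category X" "omega_functor X A f" "x \<in> Cell X (Suc n)"
  shows "slice_tgt A n (slice_pairing X f \<alpha> (Suc n) x) = slice_pairing X f \<alpha> n (Tgt X n x)"
  using assms
  by (auto simp: slice_tgt_def slice_pairing_def functor_Tgt isrc_Tgt)

lemma slice_pairing_cell:
  assumes X: "omega_category X" and f: "omega_functor X A f"
    and \<alpha>: "oplax_transformation X C (\<lambda>n x. v n (f n x)) (const_functor C c) \<alpha>"
    and "x \<in> Cell X n"
  shows "slice_pairing X f \<alpha> n x \<in> slice_cells A v C c n"
proof -
  have top: "slice_top A v C c n (slice_pairing X f \<alpha> n x)" if "x \<in> Cell X n" for n x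
  proof -
    have "arrow C n (\<alpha> n x)
        (oplax_left C n (\<lambda>j. \<alpha> j (itgt X j n x)) n (v n (f n x)))
        (oplax_right C n (const_functor C c n x) (\<lambda>j. \<alpha> j (isrc X j n x)) n)"
      using \<alpha> that unfolding oplax_transformation_def by blast
    moreover have "oplax_left C n (\<lambda>j. map (\<lambda>j. \<alpha> j (itgt X j n x)) [0..<n] ! j) n z =
        oplax_left C n (\<lambda>j. \<alpha> j (itgt X j n x)) n z" for z
      by (rule oplax_left_cong) simp
    moreover have "oplax_right C n z (\<lambda>j. map (\<lambda>j. \<alpha> j (isrc X j n x)) [0..<n] ! j) n =
        oplax_right C n z (\<lambda>j. \<alpha> j (isrc X j n x)) n" for z
      by (rule oplax_right_cong) simp
    ultimately show ?thesis
      using functor_Cell[OF f that] by (simp add: slice_top_def slice_pairing_def const_functor_def)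
  qed
  show ?thesis
    using \<open>x \<in> Cell X n\<close>
    by (induction n arbitrary: x)
       (simp_all add: top slice_pairing_Src[OF X f] slice_pairing_Tgt[OF X f]
          Src_Cell[OF X] Tgt_Cell[OF X])
qed

lemma slice_pairing_Comp:
  assumes X: "omega_category X" and f: "omega_functor X A f"
    and \<alpha>: "oplax_transformation X C (\<lambda>n x. v n (f n x)) (const_functor C c) \<alpha>"
    and "composable X n k x y"
  shows "slice_pairing X f \<alpha> n (Comp X n k x y) =
    slice_comp A v C c n k (slice_pairing X f \<alpha> n x) (slice_pairing X f \<alpha> n y)"
  using \<open>composable X n k x y\<close>
proof (induction n arbitrary: x y)
  case 0
  then show ?case by (simp add: composable_def)
next
  case (Suc n)
  let ?P = "slice_pairing X f \<alpha>"
  have xy: "x \<in> Cell X (Suc n)" "y \<in> Cell X (Suc n)" "k \<le> n"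
    using Suc.prems by (auto simp: composable_def)
  let ?xy = "Comp X (Suc n) k x y"
  have top: "\<alpha> (Suc n) ?xy = oplax_comp C (Suc n) k
            (const_functor C c (Suc k) (itgt X (Suc k) (Suc n) x))
            (\<lambda>j. \<alpha> j (isrc X j (Suc n) y)) (\<alpha> (Suc n) y)
            (\<alpha> (Suc n) x) (\<lambda>j. \<alpha> j (itgt X j (Suc n) x))
            (v (Suc k) (f (Suc k) (isrc X (Suc k) (Suc n) y)))"
    using \<alpha> Suc.prems unfolding oplax_transformation_def by blast
  also have "\<dots> = oplax_comp C (Suc n) k
              (const_functor C c (Suc k) (itgt A (Suc k) (Suc n) (base (?P (Suc n) x))))
              (\<lambda>j. srcs (?P (Suc n) y) ! j) (top (?P (Suc n) y))
              (top (?P (Suc n) x)) (\<lambda>j. tgts (?P (Suc n) x) ! j)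
              (v (Suc k) (isrc A (Suc k) (Suc n) (base (?P (Suc n) y))))"
    using functor_isrc[OF X f xy(2), of "Suc k"] xy(3)
    by (auto simp: slice_pairing_def const_functor_def simp del: upt_Suc isrc.simps itgt.simps
          intro!: oplax_comp_cong)
  finally have top: "\<alpha> (Suc n) ?xy = \<dots>" .
  have srcs: "srcs (?P (Suc n) ?xy) = srcs (?P n (Src X n ?xy)) @ [top (?P n (Src X n ?xy))]"
    by (simp add: slice_pairing_def)
  have tgts: "tgts (?P (Suc n) ?xy) = tgts (?P n (Tgt X n ?xy)) @ [top (?P n (Tgt X n ?xy))]"
    by (simp add: slice_pairing_def)
  have base: "base (?P (Suc n) ?xy) = Comp A (Suc n) k (base (?P (Suc n) x)) (base (?P (Suc n) y))"
    using functor_Comp[OF f Suc.prems] by (simp add: slice_pairing_def)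
  show ?case
  proof (cases "k = n")
    case True
    have 1: "srcs (?P (Suc n) ?xy) = srcs (?P (Suc n) y)"
      unfolding srcs using Suc.prems True by (simp add: Src_Comp0[OF X] slice_pairing_def)
    have 2: "tgts (?P (Suc n) ?xy) = tgts (?P (Suc n) x)"
      unfolding tgts using Suc.prems True by (simp add: Tgt_Comp0[OF X] slice_pairing_def)
    show ?thesis
      apply (rule slice_cell.expand)
      using 1 2 base top True by (simp add: Let_def) (simp add: slice_pairing_def)
  next
    case False
    then have k: "k < n" using xy by simp
    have 1: "?P n (Src X n ?xy) = slice_comp A v C c n k
        (slice_src A n (?P (Suc n) x)) (slice_src A n (?P (Suc n) y))"
      using Suc.IH[OF composable_Src[OF X Suc.prems k]] xy k Suc.prems
      by (simp add: Src_Comp[OF X] slice_pairing_Src[OF X f])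
    have 2: "?P n (Tgt X n ?xy) = slice_comp A v C c n k
        (slice_tgt A n (?P (Suc n) x)) (slice_tgt A n (?P (Suc n) y))"
      using Suc.IH[OF composable_Tgt[OF X Suc.prems k]] xy k Suc.prems
      by (simp add: Tgt_Comp[OF X] slice_pairing_Tgt[OF X f])
    show ?thesis
      apply (rule slice_cell.expand)
      using 1 2 base top srcs tgts False by (simp add: Let_def) (simp add: slice_pairing_def)
  qed
qed

theorem slice_pairing_functor:
  assumes X: "omega_category X" and f: "omega_functor X A f"
    and \<alpha>: "oplax_transformation X C (\<lambda>n x. v n (f n x)) (const_functor C c) \<alpha>"
  shows "omega_functor X (slice A v C c) (slice_pairing X f \<alpha>)"
    and "base (slice_pairing X f \<alpha> n x) = f n x"
    and "top (slice_pairing X f \<alpha> n x) = \<alpha> n x"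
proof -
  have "slice_pairing X f \<alpha> (Suc n) (Unit X n x) = slice_unit A C n (slice_pairing X f \<alpha> n x)"
    if "x \<in> Cell X n" for n x
  proof -
    have "\<alpha> (Suc n) (Unit X n x) = Unit C (Suc n) (\<alpha> n x)"
      using \<alpha> that unfolding oplax_transformation_def by blast
    then show ?thesis
      using that f
      by (simp add: slice_unit_def slice_pairing_def Src_Unit[OF X] Tgt_Unit[OF X] functor_Unit)
  qed
  then show "omega_functor X (slice A v C c) (slice_pairing X f \<alpha>)"
    unfolding omega_functor_def
    by (simp add: slice_pairing_cell[OF assms] slice_pairing_Src[OF X f]
      slice_pairing_Tgt[OF X f] slice_pairing_Comp[OF assms])
qed (simp_all add: slice_pairing_def)

lemma slice_cells_top: "Z \<in> slice_cells A v C c n \<Longrightarrow> slice_top A v C c n Z"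
  by (cases n) auto

lemma slice_functor_srcs:
  assumes X: "omega_category X" and F: "omega_functor X (slice A v C c) F" and "x \<in> Cell X n"
  shows "srcs (F n x) = map (\<lambda>j. top (F j (isrc X j n x))) [0..<n]"
    and "tgts (F n x) = map (\<lambda>j. top (F j (itgt X j n x))) [0..<n]"
proof -
  have "srcs (F n x) = map (\<lambda>j. top (F j (isrc X j n x))) [0..<n] \<and>
        tgts (F n x) = map (\<lambda>j. top (F j (itgt X j n x))) [0..<n]"
    using \<open>x \<in> Cell X n\<close>
  proof (induction n arbitrary: x)
    case 0
    then have "slice_top A v C c 0 (F 0 x)"
      using functor_Cell[OF F] slice_cells_top by fastforce
    then show ?case by (simp add: slice_top_def)
  next
    case (Suc n)
    have "slice_top A v C c (Suc n) (F (Suc n) x)"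
      using functor_Cell[OF F Suc.prems] slice_cells_top by fastforce
    then have ne: "srcs (F (Suc n) x) \<noteq> []" "tgts (F (Suc n) x) \<noteq> []"
      by (auto simp: slice_top_def)
    have s: "F n (Src X n x) = slice_src A n (F (Suc n) x)"
      and t: "F n (Tgt X n x) = slice_tgt A n (F (Suc n) x)"
      using functor_Src[OF F Suc.prems] functor_Tgt[OF F Suc.prems] by simp_all
    have "srcs (F (Suc n) x) = srcs (F n (Src X n x)) @ [top (F n (Src X n x))]"
      using ne(1) unfolding s by (simp add: slice_src_def)
    moreover have "tgts (F (Suc n) x) = tgts (F n (Tgt X n x)) @ [top (F n (Tgt X n x))]"
      using ne(2) unfolding t by (simp add: slice_tgt_def)
    ultimately show ?case
      using Suc.IH[OF Src_Cell[OF X Suc.prems]] Suc.IH[OF Tgt_Cell[OF X Suc.prems]] by simp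
  qed
  then show "srcs (F n x) = map (\<lambda>j. top (F j (isrc X j n x))) [0..<n]"
    and "tgts (F n x) = map (\<lambda>j. top (F j (itgt X j n x))) [0..<n]" by auto
qed

lemma base_slice_comp:
  "0 < n \<Longrightarrow> base (slice_comp A v C c n k Z W) = Comp A n k (base Z) (base W)"
  by (cases n) (auto simp: Let_def)

lemma top_slice_comp:
  "0 < n \<Longrightarrow> top (slice_comp A v C c n k Z W) =
     oplax_comp C n k (const_functor C c (Suc k) (itgt A (Suc k) n (base Z)))
       (\<lambda>j. srcs W ! j) (top W) (top Z) (\<lambda>j. tgts Z ! j) (v (Suc k) (isrc A (Suc k) n (base W)))"
  by (cases n) (auto simp: Let_def)

theorem slice_functor_pair:
  assumes X: "omega_category X" and F: "omega_functor X (slice A v C c) F"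
  shows "omega_functor X A (\<lambda>n x. base (F n x))"
    and "oplax_transformation X C (\<lambda>n x. v n (base (F n x))) (const_functor C c) (\<lambda>n x. top (F n x))"
    and "x \<in> Cell X n \<Longrightarrow>
      slice_pairing X (\<lambda>n x. base (F n x)) (\<lambda>n x. top (F n x)) n x = F n x"
proof -
  have top: "slice_top A v C c n (F n x)" if "x \<in> Cell X n" for n x
    using functor_Cell[OF F that] slice_cells_top by fastforce
  show f: "omega_functor X A (\<lambda>n x. base (F n x))"
    unfolding omega_functor_def
  proof (intro conjI allI ballI impI)
    fix n k x y assume "composable X n k x y"
    then show "base (F n (Comp X n k x y)) = Comp A n k (base (F n x)) (base (F n y))"
      by (subst functor_Comp[OF F]) (auto simp: base_slice_comp composable_def)
  qed (use top in \<open>auto simp: slice_top_def functor_Src[OF F] functor_Tgt[OF F] functor_Unit[OF F]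
         slice_src_def slice_tgt_def slice_unit_def\<close>)
  show "oplax_transformation X C (\<lambda>n x. v n (base (F n x))) (const_functor C c) (\<lambda>n x. top (F n x))"
    unfolding oplax_transformation_def
  proof (intro conjI allI ballI impI)
    fix n x assume x: "x \<in> Cell X n"
    have "oplax_left C n (\<lambda>j. top (F j (itgt X j n x))) n z = oplax_left C n (\<lambda>j. tgts (F n x) ! j) n z" for z
      by (rule oplax_left_cong) (simp add: slice_functor_srcs[OF X F x])
    moreover have "oplax_right C n z (\<lambda>j. top (F j (isrc X j n x))) n = oplax_right C n z (\<lambda>j. srcs (F n x) ! j) n" for z
      by (rule oplax_right_cong) (simp add: slice_functor_srcs[OF X F x])
    ultimately show "arrow C n (top (F n x))
        (oplax_left C n (\<lambda>j. top (F j (itgt X j n x))) n (v n (base (F n x))))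
        (oplax_right C n (const_functor C c n x) (\<lambda>j. top (F j (isrc X j n x))) n)"
      using top[OF x] by (simp add: slice_top_def const_functor_def)
  next
    fix n x assume "x \<in> Cell X n"
    then show "top (F (Suc n) (Unit X n x)) = Unit C (Suc n) (top (F n x))"
      by (simp add: functor_Unit[OF F] slice_unit_def)
  next
    fix n k x y assume c: "composable X n k x y"
    then have xy: "k < n" "x \<in> Cell X n" "y \<in> Cell X n" by (auto simp: composable_def)
    have "base (F (Suc k) (isrc X (Suc k) n y)) = isrc A (Suc k) n (base (F n y))"
      using functor_isrc[OF X f xy(3), of "Suc k"] xy(1) by simp
    moreover have "top (F n (Comp X n k x y)) = top (slice_comp A v C c n k (F n x) (F n y))"
      using functor_Comp[OF F c] by simp
    ultimately show "top (F n (Comp X n k x y)) =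
          oplax_comp C n k
            (const_functor C c (Suc k) (itgt X (Suc k) n x)) (\<lambda>j. top (F j (isrc X j n y))) (top (F n y))
            (top (F n x)) (\<lambda>j. top (F j (itgt X j n x)))
            (v (Suc k) (base (F (Suc k) (isrc X (Suc k) n y))))"
      using xy
      by (auto simp: top_slice_comp const_functor_def slice_functor_srcs[OF X F] intro!: oplax_comp_cong)
  qed
  show "x \<in> Cell X n \<Longrightarrow> slice_pairing X (\<lambda>n x. base (F n x)) (\<lambda>n x. top (F n x)) n x = F n x"
    by (rule slice_cell.expand) (simp add: slice_pairing_def slice_functor_srcs[OF X F])
qed

theorem slice_pairing_natural:
  assumes "omega_category X" "omega_functor X X' h" "x \<in> Cell X n"
  shows "slice_pairing X (\<lambda>n x. f n (h n x)) (\<lambda>n x. \<alpha> n (h n x)) n x =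
         slice_pairing X' f \<alpha> n (h n x)"
  using assms by (auto simp: slice_pairing_def functor_isrc functor_itgt)

theorem slice_map_pairing:
  "slice_map u n (slice_pairing X f \<alpha> n x) = slice_pairing X (\<lambda>n x. u n (f n x)) \<alpha> n x"
  by (simp add: slice_map_def slice_pairing_def)

theorem slice_map_functor:
  assumes A: "omega_category A" and u: "omega_functor A B u"
    and wu: "\<And>n x. x \<in> Cell A n \<Longrightarrow> w n (u n x) = v n x"
  shows "omega_functor (slice A v C c) (slice B w C c) (slice_map u)"
proof -
  have base: "base Z \<in> Cell A n" if "Z \<in> slice_cells A v C c n" for n Z
    using slice_cells_top[OF that] by (simp add: slice_top_def)
  have s: "slice_map u n (slice_src A n Z) = slice_src B n (slice_map u (Suc n) Z)"
    and t: "slice_map u n (slice_tgt A n Z) = slice_tgt B n (slice_map u (Suc n) Z)"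
    if "base Z \<in> Cell A (Suc n)" for n and Z :: "('a, 'c) slice_cell"
    using that by (simp_all add: slice_map_def slice_src_def slice_tgt_def functor_Src[OF u] functor_Tgt[OF u])
  have top: "slice_top B w C c n (slice_map u n Z)" if "slice_top A v C c n Z" for n Z
    using that by (simp add: slice_top_def slice_map_def functor_Cell[OF u] wu const_functor_def)
  have cell: "slice_map u n Z \<in> slice_cells B w C c n" if "Z \<in> slice_cells A v C c n" for n Z
    using that
  proof (induction n arbitrary: Z)
    case 0
    then show ?case by (simp add: top)
  next
    case (Suc n)
    have "slice_map u n (slice_src A n Z) \<in> slice_cells B w C c n"
      and "slice_map u n (slice_tgt A n Z) \<in> slice_cells B w C c n"
      using Suc by auto
    then show ?case
      using Suc.prems top s[OF base[OF Suc.prems]] t[OF base[OF Suc.prems]] by simp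
  qed
  have base_isrc: "base (isrc (slice A v C c) k n Z) = isrc A k n (base Z)" for k n Z
    by (induction n arbitrary: Z) (auto simp: slice_src_def)
  have base_itgt: "base (itgt (slice A v C c) k n Z) = itgt A k n (base Z)" for k n Z
    by (induction n arbitrary: Z) (auto simp: slice_tgt_def)
  have comp: "slice_map u n (slice_comp A v C c n k Z W) =
      slice_comp B w C c n k (slice_map u n Z) (slice_map u n W)"
    if "composable A n k (base Z) (base W)" for n k Z W
    using that
  proof (induction n arbitrary: Z W)
    case 0
    then show ?case by (simp add: composable_def)
  next
    case (Suc n)
    have ZW: "base Z \<in> Cell A (Suc n)" "base W \<in> Cell A (Suc n)" "k \<le> n"
      using Suc.prems by (auto simp: composable_def)
    let ?S = "slice_comp A v C c n k (slice_src A n Z) (slice_src A n W)"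
    let ?T = "slice_comp A v C c n k (slice_tgt A n Z) (slice_tgt A n W)"
    let ?S' = "slice_comp B w C c n k (slice_src B n (slice_map u (Suc n) Z)) (slice_src B n (slice_map u (Suc n) W))"
    let ?T' = "slice_comp B w C c n k (slice_tgt B n (slice_map u (Suc n) Z)) (slice_tgt B n (slice_map u (Suc n) W))"
    have ST: "srcs ?S' = srcs ?S" "top ?S' = top ?S" "tgts ?T' = tgts ?T" "top ?T' = top ?T" if "k \<noteq> n"
    proof -
      have k: "k < n" using that ZW by simp
      have 1: "?S' = slice_map u n ?S" and 2: "?T' = slice_map u n ?T"
        using Suc.IH[of "slice_src A n Z" "slice_src A n W"] Suc.IH[of "slice_tgt A n Z" "slice_tgt A n W"]
          composable_Src[OF A Suc.prems k] composable_Tgt[OF A Suc.prems k] s ZW t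
        by (simp_all add: slice_src_def slice_tgt_def)
      show "srcs ?S' = srcs ?S" "top ?S' = top ?S" "tgts ?T' = tgts ?T" "top ?T' = top ?T"
        unfolding 1 2 by (simp_all add: slice_map_def)
    qed
    have cell: "isrc A (Suc k) (Suc n) (base W) \<in> Cell A (Suc k)"
    proof -
      have "isrc A j m x \<in> Cell A j" if "x \<in> Cell A m" "j \<le> m" for j m x
        using that by (induction m arbitrary: x) (auto simp: Src_Cell[OF A] not_le le_Suc_eq)
      then show ?thesis using ZW by (simp del: isrc.simps)
    qed
    have v: "w (Suc k) (isrc B (Suc k) (Suc n) (u (Suc n) (base W))) =
        v (Suc k) (isrc A (Suc k) (Suc n) (base W))"
      using functor_isrc[OF A u ZW(2), of "Suc k"] ZW(3) wu[OF cell] by (simp del: isrc.simps)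
    show ?case
      apply (rule slice_cell.expand)
      using ST[unfolded slice_map_def] v functor_Comp[OF u Suc.prems]
      by (cases "k = n") (simp_all add: Let_def slice_map_def const_functor_def del: isrc.simps itgt.simps)
  qed
  show ?thesis
    unfolding omega_functor_def
  proof (intro conjI allI ballI impI)
    fix n k Z W assume c: "composable (slice A v C c) n k Z W"
    have "composable A n k (base Z) (base W)"
      using c base base_isrc[of k n Z] base_itgt[of k n W] by (auto simp: composable_def)
    then show "slice_map u n (Comp (slice A v C c) n k Z W) =
        Comp (slice B w C c) n k (slice_map u n Z) (slice_map u n W)"
      using comp by simp
  next
    fix n Z assume "Z \<in> Cell (slice A v C c) n"
    then show "slice_map u (Suc n) (Unit (slice A v C c) n Z) = Unit (slice B w C c) n (slice_map u n Z)"
      using base functor_Unit[OF u] by (simp add: slice_map_def slice_unit_def)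
  next
    fix n Z assume "Z \<in> Cell (slice A v C c) (Suc n)"
    then have "base Z \<in> Cell A (Suc n)" using base[of Z "Suc n"] by simp
    then show "slice_map u n (Src (slice A v C c) n Z) = Src (slice B w C c) n (slice_map u (Suc n) Z)"
      and "slice_map u n (Tgt (slice A v C c) n Z) = Tgt (slice B w C c) n (slice_map u (Suc n) Z)"
      using s t by simp_all
  qed (simp add: cell)
qed

end

theory Submission
  imports Defs
begin

text \<open>
  Every cell of \<open>B\<close> lifts to a slice: the \<open>(n+1)\<close>-cell \<open>\<beta>\<close> lifts to \<open>B/t\<^sub>0(w \<beta>)\<close> with the value
  of the transformation on \<open>t\<^sub>k \<beta>\<close> an identity, the value on \<open>s\<^sub>k \<beta>\<close> equal to \<open>w (t\<^bsub>k+1\<^esub> \<beta>)\<close> and the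
  value on \<open>\<beta>\<close> itself an identity.  If the source and target of \<open>\<beta>\<close> are images under \<open>u\<close> of
  parallel cells of \<open>A\<close>, then the source and target of this lift are images under \<open>u/c\<^sub>0\<close> of
  parallel cells of \<open>A/c\<^sub>0\<close>.  So the two conditions for \<open>u/c\<^sub>0\<close>, applied to these lifts, give those
  for \<open>u\<close>, because the projection \<open>B/c\<^sub>0 \<rightarrow> B\<close> preserves \<open>\<sim>\<^sub>\<omega>\<close>.
\<close>

lemma iunit_self [simp]: "iunit C n n x = x"
  by (cases n) auto

lemma iunit_Unit: "k < n \<Longrightarrow> iunit C (Suc k) n (Unit C k x) = iunit C k n x"
  by (induction n) (auto simp: not_le less_Suc_eq)

context
  fixes C :: "'c omega_cat"
  assumes C: "omega_category C"
begin

lemma Comp_unit_left: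
  "x \<in> Cell C n \<Longrightarrow> k < n \<Longrightarrow> Comp C n k (iunit C k n (itgt C k n x)) x = x"
  using C unfolding omega_category_def by blast

lemma itgt_Cell: "x \<in> Cell C n \<Longrightarrow> k \<le> n \<Longrightarrow> itgt C k n x \<in> Cell C k"
  by (induction n arbitrary: x) (auto simp: Tgt_Cell[OF C] le_Suc_eq)

lemma iunit_Cell: "x \<in> Cell C k \<Longrightarrow> k \<le> n \<Longrightarrow> iunit C k n x \<in> Cell C n"
  by (induction n) (auto simp: Unit_Cell[OF C] le_Suc_eq)

lemma itgt_iunit:
  "x \<in> Cell C k \<Longrightarrow> j \<le> k \<Longrightarrow> k \<le> n \<Longrightarrow> itgt C j n (iunit C k n x) = itgt C j k x"
  by (induction n) (auto simp: Tgt_Unit[OF C] iunit_Cell le_Suc_eq)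

lemma Tgt_itgt: "k < n \<Longrightarrow> Tgt C k (itgt C (Suc k) n x) = itgt C k n x"
  by (induction n arbitrary: x) (auto simp: less_Suc_eq)

text \<open>Padded to dimension \<open>n\<close>, the j-th factor is the iterated unit on the
  j-target of \<open>z\<close>, so the left unit law absorbs the factors one at a time.\<close>

lemma oplax_left_units:
  assumes "z \<in> Cell C n" "k \<le> n"
  shows "oplax_left C n (\<lambda>j. Unit C j (itgt C j n z)) k z = z"
  using assms(2) by (induction k) (auto simp: iunit_Unit Comp_unit_left[OF assms(1)])

text \<open>By induction the composite so far is an iterated unit on the k-target, hence a left unit
  for the next factor, which alone survives. At \<open>k = n\<close> this leaves \<open>z\<close>
  itself.\<close>

lemma oplax_right_faces:
  assumes "z \<in> Cell C n" "k \<le> n"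
  shows "oplax_right C n (iunit C 0 n (itgt C 0 n z)) (\<lambda>j. itgt C (Suc j) n z) k =
    iunit C k n (itgt C k n z)"
  using assms(2)
proof (induction k)
  case (Suc k)
  let ?y = "iunit C (Suc k) n (itgt C (Suc k) n z)"
  have t: "itgt C (Suc k) n z \<in> Cell C (Suc k)"
    using itgt_Cell assms(1) Suc.prems by blast
  then have "itgt C k n ?y = itgt C k n z"
    using Suc.prems by (simp add: itgt_iunit Tgt_itgt)
  then show ?case
    using Suc Comp_unit_left[OF iunit_Cell[OF t Suc.prems], of k] by simp
qed simp

end

text \<open>
  The slice cell over \<open>b\<close> with top \<open>\<gamma>\<close> whose values on target faces are identities.  The typing of
  the top cell then forces the values on source faces and the object \<open>t\<^sub>0 \<gamma>\<close>.
\<close>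

definition slice_lift :: "'c omega_cat \<Rightarrow> nat \<Rightarrow> 'a \<Rightarrow> 'c \<Rightarrow> ('a, 'c) slice_cell" where
  "slice_lift C n b \<gamma> =
     SliceCell b (map (\<lambda>j. itgt C (Suc j) (Suc n) \<gamma>) [0..<n])
       (map (\<lambda>j. Unit C j (itgt C j (Suc n) \<gamma>)) [0..<n]) \<gamma>"

lemma base_slice_lift [simp]: "base (slice_lift C n b \<gamma>) = b"
  by (simp add: slice_lift_def)

lemma slice_map_lift [simp]:
  "slice_map u n (slice_lift C n b \<gamma>) = slice_lift C n (u n b) \<gamma>"
  by (simp add: slice_lift_def slice_map_def)

text \<open>The last entry of \<open>srcs\<close> has index \<open>n\<close>, so it is the
  (n+1)-dimensional target of \<open>\<gamma>\<close>: a source in the slice takes a target in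
  \<open>C\<close>.\<close>

lemma slice_src_lift:
  "slice_src D n (slice_lift C (Suc n) b \<gamma>) = slice_lift C n (Src D n b) (Tgt C (Suc n) \<gamma>)"
  by (simp add: slice_src_def slice_lift_def)

lemma slice_tgt_lift:
  assumes C: "omega_category C" and "\<gamma> \<in> Cell C (Suc (Suc n))"
  shows "slice_tgt D n (slice_lift C (Suc n) b \<gamma>) =
    slice_lift C n (Tgt D n b) (Unit C n (Tgt C n (Tgt C (Suc n) \<gamma>)))"
  using assms by (simp add: slice_tgt_def slice_lift_def Tgt_Unit[OF C] Tgt_Cell[OF C])

text \<open>Slice cells are defined by recursion on faces, and both faces of a lift are again lifts
  over the same object, so induction reduces the claim to the typing of the top cell.\<close>

lemma slice_lift_cell:
  assumes C: "omega_category C" and D: "omega_category D" and w: "omega_functor D C w"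
  shows "b \<in> Cell D n \<Longrightarrow> \<gamma> \<in> Cell C (Suc n) \<Longrightarrow> Src C n \<gamma> = w n b \<Longrightarrow>
    slice_lift C n b \<gamma> \<in> slice_cells D w C (itgt C 0 (Suc n) \<gamma>) n"
proof -
  have top: "slice_top D w C (itgt C 0 (Suc n) \<gamma>) n (slice_lift C n b \<gamma>)"
    if b: "b \<in> Cell D n" and \<gamma>: "\<gamma> \<in> Cell C (Suc n)" and s: "Src C n \<gamma> = w n b" for n b \<gamma>
  proof -
    \<comment> \<open>By globularity \<open>\<gamma>\<close> and its source \<open>w n b\<close>
      have the same j-targets for \<open>j < n\<close>, so the values on target faces are units on
      faces of \<open>w n b\<close>.\<close>
    have "oplax_left C n (\<lambda>j. tgts (slice_lift C n b \<gamma>) ! j) n (w n b) =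
        oplax_left C n (\<lambda>j. Unit C j (itgt C j n (w n b))) n (w n b)"
      by (rule oplax_left_cong) (use itgt_Src[OF C \<gamma>] s in \<open>simp add: slice_lift_def\<close>)
    then have "oplax_left C n (\<lambda>j. tgts (slice_lift C n b \<gamma>) ! j) n (w n b) = w n b"
      using oplax_left_units[OF C functor_Cell[OF w b]] by simp
    moreover have "oplax_right C n z (\<lambda>j. srcs (slice_lift C n b \<gamma>) ! j) n =
        oplax_right C n z (\<lambda>j. itgt C (Suc j) n (Tgt C n \<gamma>)) n" for z
      by (rule oplax_right_cong) (simp add: slice_lift_def)
    ultimately show ?thesis
      using oplax_right_faces[OF C Tgt_Cell[OF C \<gamma>], of n] b \<gamma> s
      by (simp add: slice_top_def arrow_def const_functor_def) (simp add: slice_lift_def)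
  qed
  show "b \<in> Cell D n \<Longrightarrow> \<gamma> \<in> Cell C (Suc n) \<Longrightarrow> Src C n \<gamma> = w n b \<Longrightarrow>
    slice_lift C n b \<gamma> \<in> slice_cells D w C (itgt C 0 (Suc n) \<gamma>) n"
  proof (induction n arbitrary: b \<gamma>)
    case 0
    then show ?case using top[of b 0] by simp
  next
    case (Suc n)
    let ?T = "Tgt C n (Tgt C (Suc n) \<gamma>)"
    have T: "?T \<in> Cell C n"
      using Suc.prems(2) by (simp add: Tgt_Cell[OF C])
    have s: "Src C n (Tgt C (Suc n) \<gamma>) = w n (Src D n b)"
      using Suc.prems by (simp add: Src_Tgt[OF C] functor_Src[OF w])
    have t: "?T = w n (Tgt D n b)"
      using Suc.prems by (simp add: Tgt_Src[OF C, symmetric] functor_Tgt[OF w])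
    have "slice_lift C n (Src D n b) (Tgt C (Suc n) \<gamma>)
        \<in> slice_cells D w C (itgt C 0 (Suc (Suc n)) \<gamma>) n"
      using Suc.IH[OF Src_Cell[OF D Suc.prems(1)] Tgt_Cell[OF C Suc.prems(2)] s] by simp
    moreover have "slice_lift C n (Tgt D n b) (Unit C n ?T)
        \<in> slice_cells D w C (itgt C 0 (Suc (Suc n)) \<gamma>) n"
      using Suc.IH[OF Tgt_Cell[OF D Suc.prems(1)] Unit_Cell[OF C T]] T t
      by (simp add: Src_Unit[OF C] Tgt_Unit[OF C])
    ultimately show ?case
      using top[OF Suc.prems] Suc.prems
      by (simp add: slice_src_lift slice_tgt_lift[OF C])
  qed
qed

text \<open>\<open>base\<close> commutes strictly with faces, units and compositions, so it carries
  witnesses \<open>r\<close>, \<open>q\<close> to witnesses. Coinduction handles their composites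
  one dimension higher.\<close>

lemma omega_equiv_base:
  assumes "omega_equiv (slice B w C c) n Z W"
  shows "omega_equiv B n (base Z) (base W)"
  using assms
proof (coinduction arbitrary: n Z W)
  case omega_equiv
  have base: "base Z \<in> Cell B n" if "Z \<in> slice_cells B w C c n" for Z n
    using slice_cells_top[OF that] by (simp add: slice_top_def)
  from omega_equiv obtain r q where
    p: "parallel (slice B w C c) n Z W"
    and r: "arrow (slice B w C c) n r Z W" and q: "arrow (slice B w C c) n q W Z"
    and e: "omega_equiv (slice B w C c) (Suc n) (slice_comp B w C c (Suc n) n r q) (slice_unit B C n W)"
      "omega_equiv (slice B w C c) (Suc n) (slice_comp B w C c (Suc n) n q r) (slice_unit B C n Z)"
    by (cases rule: omega_equiv.cases) auto
  have "parallel B n (base Z) (base W)"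
    using p base unfolding parallel_def
    by (auto simp: slice_src_def slice_tgt_def)
  moreover have "arrow B n (base r) (base Z) (base W)" "arrow B n (base q) (base W) (base Z)"
    using r q base[of _ "Suc n"] unfolding arrow_def
    by (auto simp: slice_src_def slice_tgt_def simp del: slice_cells.simps)
  moreover have "base (slice_comp B w C c (Suc n) n x y) = Comp B (Suc n) n (base x) (base y)" for x y
    by (simp add: base_slice_comp del: slice_comp.simps)
  moreover have "base (slice_unit B C n x) = Unit B n (base x)" for x :: "('a, 'b) slice_cell"
    by (simp add: slice_unit_def)
  ultimately show ?case
    using e by metis
qed

theorem theorem3p7p4:
  fixes A :: "'a omega_cat" and B :: "'b omega_cat" and C :: "'c omega_cat"
    and u :: "nat \<Rightarrow> 'a \<Rightarrow> 'b" and v :: "nat \<Rightarrow> 'a \<Rightarrow> 'c" and w :: "nat \<Rightarrow> 'b \<Rightarrow> 'c"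
  assumes "omega_category A" and "omega_category B" and "omega_category C"
    and "omega_functor A B u" and "omega_functor A C v" and "omega_functor B C w"
    and "\<And>n x. x \<in> Cell A n \<Longrightarrow> w n (u n x) = v n x"
    and "\<And>c. c \<in> Cell C 0 \<Longrightarrow>
           omega_equivalence (slice A v C c) (slice B w C c) (slice_map u)"
  shows "omega_equivalence A B u"
proof -
  note A = assms(1) and B = assms(2) and C = assms(3)
  note u = assms(4) and v = assms(5) and w = assms(6) and wu = assms(7) and slices = assms(8)
  have "\<exists>x\<in>Cell A 0. omega_equiv B 0 (u 0 x) y" if y: "y \<in> Cell B 0" for y
  proof -
    \<comment> \<open>Over this object \<open>y\<close> lifts with an identity as its structure
      1-cell.\<close>
    let ?c = "w 0 y"
    have c: "?c \<in> Cell C 0" by (rule functor_Cell[OF w y])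
    have "slice_lift C 0 y (Unit C 0 ?c) \<in> slice_cells B w C ?c 0"
      using slice_lift_cell[OF C B w y Unit_Cell[OF C c]] c
      by (simp add: Src_Unit[OF C] Tgt_Unit[OF C])
    then obtain X where X: "X \<in> slice_cells A v C ?c 0"
      and e: "omega_equiv (slice B w C ?c) 0 (slice_map u 0 X) (slice_lift C 0 y (Unit C 0 ?c))"
      using slices[OF c] unfolding omega_equivalence_def by (auto simp del: slice_cells.simps)
    show ?thesis
      using omega_equiv_base[OF e] slice_cells_top[OF X]
      by (auto simp: slice_top_def slice_map_def)
  qed
  moreover have "\<exists>\<alpha>. arrow A n \<alpha> x y \<and> omega_equiv B (Suc n) (u (Suc n) \<alpha>) \<beta>"
    if p: "parallel A n x y" and \<beta>: "arrow B n \<beta> (u n x) (u n y)" for n x y \<beta>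
  proof -
    let ?\<gamma> = "w (Suc n) \<beta>"
    let ?c = "itgt C 0 (Suc n) ?\<gamma>"
    \<comment> \<open>The source and target of \<open>?\<beta>\<close> have tops
      \<open>?\<gamma>\<close> and the unit on its target \<open>v n y\<close>. Since
      \<open>w\<close> after \<open>u\<close> is \<open>v\<close>, the same tops serve over
      \<open>x\<close> and \<open>y\<close> in \<open>A\<close>.\<close>
    let ?x = "slice_lift C n x ?\<gamma>" and ?y = "slice_lift C n y (Unit C n (v n y))"
    let ?\<beta> = "slice_lift C (Suc n) \<beta> (Unit C (Suc n) ?\<gamma>)"
    have xy: "x \<in> Cell A n" "y \<in> Cell A n" using p by (auto simp: parallel_def)
    have \<beta>': "\<beta> \<in> Cell B (Suc n)" "Src B n \<beta> = u n x" "Tgt B n \<beta> = u n y"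
      using \<beta> by (auto simp: arrow_def)
    have \<gamma>: "?\<gamma> \<in> Cell C (Suc n)" "Src C n ?\<gamma> = v n x" "Tgt C n ?\<gamma> = v n y"
      using functor_Cell[OF w \<beta>'(1)] functor_Src[OF w \<beta>'(1)] functor_Tgt[OF w \<beta>'(1)] \<beta>' wu xy
      by auto
    have vy: "v n y \<in> Cell C n" by (rule functor_Cell[OF v xy(2)])
    have c: "?c \<in> Cell C 0" by (rule itgt_Cell[OF C \<gamma>(1)]) simp
    have x_cell: "?x \<in> slice_cells A v C ?c n"
      by (rule slice_lift_cell[OF C A v xy(1) \<gamma>(1,2)])
    have y_cell: "?y \<in> slice_cells A v C ?c n"
      using slice_lift_cell[OF C A v xy(2) Unit_Cell[OF C vy]] vy \<gamma>(3)
      by (simp add: Src_Unit[OF C] Tgt_Unit[OF C])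
    have \<beta>_cell: "?\<beta> \<in> slice_cells B w C ?c (Suc n)"
      using slice_lift_cell[OF C B w \<beta>'(1) Unit_Cell[OF C \<gamma>(1)]] \<gamma>(1)
      by (simp add: Src_Unit[OF C] Tgt_Unit[OF C] del: slice_cells.simps)
    \<comment> \<open>For \<open>n > 0\<close> the faces of a lift depend only on the faces of its
      base and the target of its top. Here \<open>x\<close>, \<open>y\<close> are parallel and both
      tops have target \<open>v n y\<close>.\<close>
    have "parallel (slice A v C ?c) n ?x ?y"
      using x_cell y_cell p \<gamma> vy
      by (auto simp: parallel_def slice_src_lift slice_tgt_lift[OF C] Tgt_Unit[OF C] Unit_Cell[OF C]
          simp del: slice_cells.simps itgt.simps)
    moreover have "arrow (slice B w C ?c) n ?\<beta> (slice_map u n ?x) (slice_map u n ?y)"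
      using \<beta>_cell \<beta>' \<gamma>
      by (simp add: arrow_def slice_src_lift slice_tgt_lift[OF C] Tgt_Unit[OF C] Unit_Cell[OF C]
          del: slice_cells.simps itgt.simps)
    ultimately obtain Z where Z: "arrow (slice A v C ?c) n Z ?x ?y"
      and e: "omega_equiv (slice B w C ?c) (Suc n) (slice_map u (Suc n) Z) ?\<beta>"
      using slices[OF c] unfolding omega_equivalence_def by blast
    have Zc: "Z \<in> slice_cells A v C ?c (Suc n)" "slice_src A n Z = ?x" "slice_tgt A n Z = ?y"
      using Z by (simp_all add: arrow_def del: slice_cells.simps itgt.simps)
    \<comment> \<open>Forgetting the transformation values turns the slice cell \<open>Z\<close>
      into the required lift of \<open>\<beta>\<close>.\<close>
    have "arrow A n (base Z) x y"
      using slice_cells_top[OF Zc(1)] arg_cong[OF Zc(2), of base] arg_cong[OF Zc(3), of base]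
      by (simp add: arrow_def slice_top_def slice_src_def slice_tgt_def)
    moreover have "omega_equiv B (Suc n) (u (Suc n) (base Z)) \<beta>"
      using omega_equiv_base[OF e] by (simp add: slice_map_def)
    ultimately show ?thesis by blast
  qed
  ultimately show ?thesis
    using u unfolding omega_equivalence_def by blast
qed

end
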